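(* In the setting of the order-$q$ decoupled Gaussian chaos process $(C_t^{(q)})_{t\in T}$ described in the context, the maps $\{d_{\mathcal P}\}_{\mathcal P\in\mathfrak P_q}$ are finite-valued, jointly Borel pseudo-metrics on $T$, and $(T,\rho)$ is separable. For every $s,t\in T$ and every $u\ge0$, $$\mathbb P\Big\{|C_s^{(q)}-C_t^{(q)}|>\sum_{\mathcal P\in\mathfrak P_q}u^{|\mathcal P|/2}d_{\mathcal P}(s,t)\Big\}\le2e^{-u}.$$ The process $(C_t^{(q)})_{t\in T}$ is jointly measurable and has almost surely $\rho$-continuous sample paths. Consequently, it is an anchored $\mathsf B_q$-regime mixed-tail process with orders $\alpha_{\mathcal P}=2/|\mathcal P|$, $\mathcal P\in\mathfrak P_q$.
   Context: Chaos process. Fix an integer $q\ge2$ and positive integers $n_1,\ldots,n_q$. Let $g^{(r)}=(g^{(r)}_1,\ldots,g^{(r)}_{n_r})\sim N(0,I_{n_r})$, $r=1,\ldots,q$, be independent. Write $[n]:=\{1,\ldots,n\}$, $\mathcal I:=[n_1]\times\cdots\times[n_q]$; for $\boldsymbol i=(i_1,\ldots,i_q)\in\mathcal I$ and nonempty $I\subseteq[q]$, $\boldsymbol i_I:=(i_r)_{r\in I}$ and $\mathcal I_I:=\prod_{r\in I}[n_r]$. Let $(T,\mathcal A)$ be a standard Borel space and $t\mapsto A_t=(a_{\boldsymbol i}(t))_{\boldsymbol i\in\mathcal I}$ a Borel measurable map from $T$ to $\mathbb R^{n_1\times\cdots\times n_q}$, with an anchor $t_0\in T$ such that $A_{t_0}=0$.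 Define $$C_t^{(q)}:=\sum_{\boldsymbol i\in\mathcal I}a_{\boldsymbol i}(t)\prod_{r=1}^q g^{(r)}_{i_r},\qquad t\in T.$$ Partition norms. $\mathfrak P_q$ is the set of all partitions of $[q]$ (into nonempty blocks); its cardinality is the Bell number $\mathsf B_q$; $|\mathcal P|$ is the number of blocks. For $\mathcal P=\{I_1,\ldots,I_k\}\in\mathfrak P_q$ and a tensor $A=(a_{\boldsymbol i})_{\boldsymbol i\in\mathcal I}$, $$\|A\|_{\mathcal P}:=\sup\Big\{\sum_{\boldsymbol i\in\mathcal I}a_{\boldsymbol i}\prod_{r=1}^k x^{(r)}_{\boldsymbol i_{I_r}}:\ x^{(r)}\in\mathbb R^{\mathcal I_{I_r}},\ \sum_{\boldsymbol j\in\mathcal I_{I_r}}(x^{(r)}_{\boldsymbol j})^2\le1,\ r=1,\ldots,k\Big\}.$$ Constants and pseudo-metrics. $L_q$ is a finite constant depending only on $q$ such that (Latała's moment inequality) for all $n_1,\ldots,n_q$, all deterministic tensors $A$ and all $p\ge2$, $\big\|\sum_{\boldsymbol i\in\mathcal I}a_{\boldsymbol i}\prod_{r=1}^q g^{(r)}_{i_r}\big\|_{L^p}\le L_q\sum_{\mathcal P\in\mathfrak P_q}p^{|\mathcal P|/2}\|A\|_{\mathcal P}$. Set $K_q:=e\,2^qL_q$, $d_{\mathcal P}(s,t):=K_q\|A_s-A_t\|_{\mathcal P}$, and $\rho(s,t):=\sum_{\mathcal P\in\mathfrak P_q}d_{\mathcal P}(s,t)$. Definition. An anchored $m$-regime mixed-tail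 process of orders $(\alpha_1,\ldots,\alpha_m)$ with respect to finite-valued jointly measurable pseudo-metrics $(d_1,\ldots,d_m)$ on $T$, with $(T,\sum_jd_j)$ separable, is a jointly measurable process $(Z_t)_{t\in T}$ with values in a separable Banach space (here $\mathbb R$) for which there is $t_0\in T$ such that, almost surely, $Z_{t_0}=0$ and $t\mapsto Z_t$ is continuous with respect to $\sum_jd_j$, and such that $\mathbb P\{\|Z_t-Z_s\|>\sum_{j=1}^m u^{1/\alpha_j}d_j(t,s)\}\le2e^{-u}$ for all $s,t\in T$, $u\ge0$. *)

theory Defs
  imports "HOL-Probability.Probability"
begin

definition standard_borel_space :: "'t measure \<Rightarrow> bool" where
  "standard_borel_space T \<longleftrightarrow>
     (\<exists>X. topspace X = space T \<and> completely_metrizable_space X \<and> separable_space X \<and>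
          sets T = sigma_sets (space T) {U. openin X U})"

(* Extended-valued, so that an upper bound on the norm also asserts membership in L^p. *)
definition Lp_norm :: "'w measure \<Rightarrow> real \<Rightarrow> ('w \<Rightarrow> real) \<Rightarrow> ereal" where
  "Lp_norm M p X =
     (if integrable M (\<lambda>\<omega>. \<bar>X \<omega>\<bar> powr p)
      then ereal ((\<integral>\<omega>. \<bar>X \<omega>\<bar> powr p \<partial>M) powr (1 / p)) else \<infinity>)"

(* N(0, I_n), with vectors of R^n as extensional functions on {1..n}. *)
definition std_gauss :: "nat \<Rightarrow> (nat \<Rightarrow> real) measure" where
  "std_gauss n = PiM {1..n} (\<lambda>_. density lborel (\<lambda>x. ennreal (std_normal_density x)))"

(* For I a subset of {1..q} this is the product of the [n_r], r in I; a multi-index is an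
   extensional function on I, so that restrict i I is the sub-multi-index i_I. *)
definition multi_idx :: "(nat \<Rightarrow> nat) \<Rightarrow> nat set \<Rightarrow> (nat \<Rightarrow> nat) set" where
  "multi_idx n I = PiE I (\<lambda>r. {1..n r})"

definition partitions :: "nat \<Rightarrow> nat set set set" where
  "partitions q = {P. partition_on {1..q} P}"

definition bell :: "nat \<Rightarrow> nat" where
  "bell q = card (partitions q)"

definition chaos_form ::
  "nat \<Rightarrow> (nat \<Rightarrow> nat) \<Rightarrow> ((nat \<Rightarrow> nat) \<Rightarrow> real) \<Rightarrow> (nat \<Rightarrow> nat \<Rightarrow> real) \<Rightarrow> real" where
  "chaos_form q n a x = (\<Sum>i\<in>multi_idx n {1..q}. a i * (\<Prod>r\<in>{1..q}. x r (i r)))"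

(* The supremum is taken in ereal, so that finiteness of the norm is a genuine assertion. *)
definition partition_norm ::
  "nat \<Rightarrow> (nat \<Rightarrow> nat) \<Rightarrow> nat set set \<Rightarrow> ((nat \<Rightarrow> nat) \<Rightarrow> real) \<Rightarrow> ereal" where
  "partition_norm q n P a =
     (SUP x\<in>{x :: nat set \<Rightarrow> (nat \<Rightarrow> nat) \<Rightarrow> real.
               \<forall>I\<in>P. (\<Sum>j\<in>multi_idx n I. (x I j)\<^sup>2) \<le> 1}.
        ereal (\<Sum>i\<in>multi_idx n {1..q}. a i * (\<Prod>I\<in>P. x I (restrict i I))))"

(* L is admissible in Latala's moment inequality of order q. The moments depend only on the law
   of the Gaussian vectors, so they are computed on the canonical product space. *)
definition latala_constant :: "nat \<Rightarrow> real \<Rightarrow> bool" where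
  "latala_constant q L \<longleftrightarrow>
     (\<forall>n a p. (\<forall>r\<in>{1..q}. 0 < n r) \<longrightarrow> 2 \<le> p \<longrightarrow>
        Lp_norm (PiM {1..q} (\<lambda>r. std_gauss (n r))) p (chaos_form q n a)
          \<le> ereal L * (\<Sum>P\<in>partitions q. ereal (p powr (real (card P) / 2)) * partition_norm q n P a))"

definition chaos_const :: "nat \<Rightarrow> real \<Rightarrow> real" where
  "chaos_const q L = exp 1 * 2 ^ q * L"

definition chaos_dist ::
  "nat \<Rightarrow> (nat \<Rightarrow> nat) \<Rightarrow> real \<Rightarrow> ('t \<Rightarrow> (nat \<Rightarrow> nat) \<Rightarrow> real) \<Rightarrow> nat set set \<Rightarrow> 't \<Rightarrow> 't \<Rightarrow> ereal" where
  "chaos_dist q n L A P s t =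
     ereal (chaos_const q L) * partition_norm q n P (\<lambda>i. A s i - A t i)"

definition chaos_rho ::
  "nat \<Rightarrow> (nat \<Rightarrow> nat) \<Rightarrow> real \<Rightarrow> ('t \<Rightarrow> (nat \<Rightarrow> nat) \<Rightarrow> real) \<Rightarrow> 't \<Rightarrow> 't \<Rightarrow> ereal" where
  "chaos_rho q n L A s t = (\<Sum>P\<in>partitions q. chaos_dist q n L A P s t)"

definition chaos_process ::
  "nat \<Rightarrow> (nat \<Rightarrow> nat) \<Rightarrow> ('t \<Rightarrow> (nat \<Rightarrow> nat) \<Rightarrow> real) \<Rightarrow> (nat \<Rightarrow> 'w \<Rightarrow> nat \<Rightarrow> real) \<Rightarrow> 't \<Rightarrow> 'w \<Rightarrow> real" where
  "chaos_process q n A g t \<omega> = chaos_form q n (A t) (\<lambda>r. g r \<omega>)"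

definition finite_valued_on :: "'t set \<Rightarrow> ('t \<Rightarrow> 't \<Rightarrow> ereal) \<Rightarrow> bool" where
  "finite_valued_on S d \<longleftrightarrow> (\<forall>s\<in>S. \<forall>t\<in>S. \<bar>d s t\<bar> \<noteq> \<infinity>)"

definition pseudo_metric_on :: "'t set \<Rightarrow> ('t \<Rightarrow> 't \<Rightarrow> ereal) \<Rightarrow> bool" where
  "pseudo_metric_on S d \<longleftrightarrow>
     (\<forall>s\<in>S. \<forall>t\<in>S. 0 \<le> d s t) \<and>
     (\<forall>t\<in>S. d t t = 0) \<and>
     (\<forall>s\<in>S. \<forall>t\<in>S. d s t = d t s) \<and>
     (\<forall>r\<in>S. \<forall>s\<in>S. \<forall>t\<in>S. d r t \<le> d r s + d s t)"

definition jointly_measurable_dist :: "'t measure \<Rightarrow> ('t \<Rightarrow> 't \<Rightarrow> ereal) \<Rightarrow> bool" where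
  "jointly_measurable_dist T d \<longleftrightarrow> (\<lambda>(s, t). d s t) \<in> borel_measurable (T \<Otimes>\<^sub>M T)"

definition separable_wrt :: "'t set \<Rightarrow> ('t \<Rightarrow> 't \<Rightarrow> ereal) \<Rightarrow> bool" where
  "separable_wrt S d \<longleftrightarrow>
     (\<exists>D. countable D \<and> D \<subseteq> S \<and> (\<forall>t\<in>S. \<forall>\<epsilon>>0. \<exists>s\<in>D. d t s < ereal \<epsilon>))"

definition continuous_wrt ::
  "'t set \<Rightarrow> ('t \<Rightarrow> 't \<Rightarrow> ereal) \<Rightarrow> ('t \<Rightarrow> 'b::metric_space) \<Rightarrow> bool" where
  "continuous_wrt S d f \<longleftrightarrow>
     (\<forall>t\<in>S. \<forall>\<epsilon>>0. \<exists>\<delta>>0. \<forall>s\<in>S. d t s < ereal \<delta> \<longrightarrow> dist (f s) (f t) < \<epsilon>)"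

definition jointly_measurable_process ::
  "'w measure \<Rightarrow> 't measure \<Rightarrow> ('t \<Rightarrow> 'w \<Rightarrow> 'b::topological_space) \<Rightarrow> bool" where
  "jointly_measurable_process M T Z \<longleftrightarrow> (\<lambda>(t, \<omega>). Z t \<omega>) \<in> borel_measurable (T \<Otimes>\<^sub>M M)"

(* The m regimes are indexed by a finite set J of cardinality m instead of {1..m}. *)
definition anchored_mixed_tail_process ::
  "nat \<Rightarrow> 'w measure \<Rightarrow> 't measure \<Rightarrow> 'j set \<Rightarrow> ('j \<Rightarrow> real) \<Rightarrow> ('j \<Rightarrow> 't \<Rightarrow> 't \<Rightarrow> ereal) \<Rightarrow>
   ('t \<Rightarrow> 'w \<Rightarrow> 'b::{banach, second_countable_topology}) \<Rightarrow> bool" where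
  "anchored_mixed_tail_process m M T J \<alpha> d Z \<longleftrightarrow>
     finite J \<and> card J = m \<and> (\<forall>j\<in>J. 0 < \<alpha> j) \<and>
     (\<forall>j\<in>J. finite_valued_on (space T) (d j) \<and> pseudo_metric_on (space T) (d j) \<and>
            jointly_measurable_dist T (d j)) \<and>
     separable_wrt (space T) (\<lambda>s t. \<Sum>j\<in>J. d j s t) \<and>
     jointly_measurable_process M T Z \<and>
     (\<exists>t0\<in>space T. AE \<omega> in M. Z t0 \<omega> = 0 \<and>
        continuous_wrt (space T) (\<lambda>s t. \<Sum>j\<in>J. d j s t) (\<lambda>t. Z t \<omega>)) \<and>
     (\<forall>s\<in>space T. \<forall>t\<in>space T. \<forall>u\<ge>0.
        measure M {\<omega> \<in> space M. ereal (norm (Z t \<omega> - Z s \<omega>)) >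
                     (\<Sum>j\<in>J. ereal (u powr (1 / \<alpha> j)) * d j t s)} \<le> 2 * exp (- u))"

end

theory Submission
  imports Defs
begin

text \<open>On tensors of a fixed format every partition norm lies between the maximum and the sum of the
  absolute values of the entries. Hence the pseudo-metrics are finite, are Lipschitz functions of
  finitely many measurable coordinates, and inherit separability from a finite-dimensional space,
  while every sample path is Lipschitz with respect to \<open>\<rho>\<close>. The tail bound is Markov's inequality
  for the moment of order \<open>max 2 u\<close>, estimated by the moment inequality applied to the tensor
  \<open>A\<^sub>s - A\<^sub>t\<close>.\<close>

section \<open>Preliminaries: tensors over a finite index set, and tails from moments\<close>

definition l1_dist :: "'i set \<Rightarrow> ('i \<Rightarrow> real) \<Rightarrow> ('i \<Rightarrow> real) \<Rightarrow> real" where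
  "l1_dist J a b = (\<Sum>i\<in>J. \<bar>a i - b i\<bar>)"

text \<open>Extensionality off \<open>J\<close> keeps this set countable; it costs nothing, since
  \<open>l1_dist J\<close> reads only the coordinates in \<open>J\<close>.\<close>

definition rational_tensors :: "'i set \<Rightarrow> ('i \<Rightarrow> real) set" where
  "rational_tensors J = PiE J (\<lambda>_. \<rat>)"

lemma countable_rational_tensors: "finite J \<Longrightarrow> countable (rational_tensors J)"
  unfolding rational_tensors_def by (intro countable_PiE) (auto simp: countable_rat)

lemma l1_dist_nonneg: "0 \<le> l1_dist J a b"
  by (simp add: l1_dist_def sum_nonneg)

lemma l1_dist_commute: "l1_dist J a b = l1_dist J b a"
  by (simp add: l1_dist_def abs_minus_commute)

lemma l1_dist_triangle: "l1_dist J a c \<le> l1_dist J a b + l1_dist J b c"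
  unfolding l1_dist_def sum.distrib[symmetric] by (intro sum_mono) auto

lemma rational_tensors_dense:
  assumes "finite J" "0 < e"
  obtains b where "b \<in> rational_tensors J" "l1_dist J a b < e"
proof -
  \<comment> \<open>The \<open>+ 1\<close> covers empty \<open>J\<close> and makes the final
    estimate \<open>card J * e' < e\<close> strict.\<close>
  define e' where "e' = e / (real (card J) + 1)"
  have e': "0 < e'" using assms by (simp add: e'_def)
  have "\<forall>i. \<exists>r\<in>\<rat>. a i < r \<and> r < a i + e'"
    using e' by (intro allI Rats_dense_in_real) auto
  then obtain r where r: "\<And>i. r i \<in> \<rat>" "\<And>i. a i < r i" "\<And>i. r i < a i + e'"
    by metis
  have "l1_dist J a (restrict r J) = (\<Sum>i\<in>J. \<bar>a i - r i\<bar>)"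
    by (simp add: l1_dist_def)
  also have "\<dots> \<le> (\<Sum>i\<in>J. e')"
    using r(2,3) by (intro sum_mono) (smt (verit))
  also have "\<dots> < e"
    using assms by (simp add: e'_def field_simps)
  finally show ?thesis
    using r(1) by (intro that[of "restrict r J"]) (auto simp: rational_tensors_def)
qed

text \<open>A 1-Lipschitz function is the infimum of the cones over a countable dense set.\<close>

lemma borel_measurable_l1_lipschitz:
  fixes f :: "('i \<Rightarrow> real) \<Rightarrow> real"
  assumes J: "finite J"
    and lip: "\<And>a b. f a \<le> f b + l1_dist J a b"
    and F: "\<And>i. i \<in> J \<Longrightarrow> (\<lambda>x. F x i) \<in> borel_measurable N"
  shows "(\<lambda>x. ereal (f (F x))) \<in> borel_measurable N"
proof -
  have eq: "ereal (f a) = (INF b\<in>rational_tensors J. ereal (f b + l1_dist J a b))" for a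
  proof (rule antisym)
    show "ereal (f a) \<le> (INF b\<in>rational_tensors J. ereal (f b + l1_dist J a b))"
      using lip by (intro INF_greatest) auto
    show "(INF b\<in>rational_tensors J. ereal (f b + l1_dist J a b)) \<le> ereal (f a)"
    proof (rule ereal_le_epsilon2)
      fix e :: real assume "0 < e"
      then obtain b where b: "b \<in> rational_tensors J" "l1_dist J a b < e / 2"
        using rational_tensors_dense[OF J, of "e / 2" a] by auto
      \<comment> \<open>Lipschitz continuity from \<open>b\<close> back to \<open>a\<close> costs
        the distance a second time, hence \<open>e / 2\<close> in the choice of
        \<open>b\<close>.\<close>
      have "f b + l1_dist J a b \<le> f a + e"
        using lip[of b a] b(2) by (simp add: l1_dist_commute)
      then show "(INF b\<in>rational_tensors J. ereal (f b + l1_dist J a b)) \<le> ereal (f a) + ereal e"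
        using b(1) by (intro INF_lower2[of b]) auto
    qed
  qed
  have "(\<lambda>x. f b + l1_dist J (F x) b) \<in> borel_measurable N" for b
    unfolding l1_dist_def using F by (intro borel_measurable_add borel_measurable_sum
      borel_measurable_abs borel_measurable_diff) auto
  then show ?thesis
    unfolding eq
    by (intro borel_measurable_INF countable_rational_tensors J borel_measurable_ereal)
qed

text \<open>The dense points must come from \<open>S\<close>, while a rational tensor need not be a
  value of \<open>A\<close>. So one point of \<open>S\<close> is chosen for each rational ball of
  radius \<open>1 / Suc m\<close> that contains the tensor of such a point. A ball around
  \<open>A t\<close> then yields a point within twice its radius.\<close>

lemma l1_dist_separable:
  fixes A :: "'t \<Rightarrow> 'i \<Rightarrow> real"
  assumes J: "finite J"
  obtains D where "countable D" "D \<subseteq> S" "\<And>t e. t \<in> S \<Longrightarrow> 0 < e \<Longrightarrow> \<exists>s\<in>D. l1_dist J (A t) (A s) < e"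
proof -
  define near where "near b m s \<longleftrightarrow> s \<in> S \<and> l1_dist J (A s) b < 1 / real (Suc m)" for b m s
  define D where "D = (\<lambda>(b, m). SOME s. near b m s) ` {(b, m). b \<in> rational_tensors J \<and> (\<exists>s. near b m s)}"
  have "countable {(b, m). b \<in> rational_tensors J \<and> (\<exists>s. near b m s)}"
    by (rule countable_subset[of _ "rational_tensors J \<times> UNIV"])
      (auto intro: countable_rational_tensors J)
  then have 1: "countable D" unfolding D_def by (rule countable_image)
  have 2: "D \<subseteq> S"
  proof
    fix s assume "s \<in> D"
    then obtain b m where "near b m s" unfolding D_def by (auto intro: someI)
    then show "s \<in> S" by (simp add: near_def)
  qed
  have 3: "\<exists>s\<in>D. l1_dist J (A t) (A s) < e" if t: "t \<in> S" and e: "0 < e" for t e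
  proof -
    obtain m where m: "1 / real (Suc m) < e / 2"
      using reals_Archimedean[of "e / 2"] e by (auto simp: inverse_eq_divide)
    obtain b where b: "b \<in> rational_tensors J" "l1_dist J (A t) b < 1 / real (Suc m)"
      using rational_tensors_dense[OF J, of "1 / real (Suc m)" "A t"] by auto
    define s where "s = (SOME s. near b m s)"
    have ex: "near b m t" using t b by (simp add: near_def)
    then have s: "near b m s" unfolding s_def by (rule someI)
    have "s \<in> D" using b(1) ex unfolding D_def s_def by (auto intro!: image_eqI[of _ _ "(b, m)"])
    moreover have "l1_dist J (A t) (A s) < e"
      using l1_dist_triangle[of J "A t" "A s" b] b(2) s m
      by (simp add: near_def l1_dist_commute)
    ultimately show ?thesis by blast
  qed
  from 1 2 3 show ?thesis by (rule that)
qed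

text \<open>Markov's inequality for the \<open>p\<close>-th power at level \<open>exp 1 * B\<close>:
  the quotient \<open>B powr p / (exp 1 * B) powr p\<close> is \<open>exp (- p)\<close>.\<close>

lemma (in prob_space) prob_gt_Lp_norm:
  assumes X: "X \<in> borel_measurable M" and p: "0 < p" and B: "0 \<le> B"
    and le: "Lp_norm M p X \<le> ereal B"
  shows "prob {\<omega> \<in> space M. exp 1 * B < \<bar>X \<omega>\<bar>} \<le> exp (- p)"
proof -
  let ?Y = "\<lambda>\<omega>. \<bar>X \<omega>\<bar> powr p"
  have int: "integrable M ?Y" using le by (auto simp: Lp_norm_def split: if_splits)
  define m where "m = expectation ?Y"
  have m0: "0 \<le> m" unfolding m_def by (intro Bochner_Integration.integral_nonneg) auto
  have "m powr (1 / p) \<le> B" using le int by (simp add: Lp_norm_def m_def)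
  then have "(m powr (1 / p)) powr p \<le> B powr p" using p by (intro powr_mono2) auto
  then have mB: "m \<le> B powr p" using p m0 by (simp add: powr_powr)
  show ?thesis
  proof (cases "B = 0")
    case True
    then have "m = 0" using mB m0 by simp
    then have "AE \<omega> in M. ?Y \<omega> = 0"
      using integral_nonneg_eq_0_iff_AE[OF int] by (simp add: m_def)
    then have "prob {\<omega> \<in> space M. exp 1 * B < \<bar>X \<omega>\<bar>} = 0"
      using X True by (subst prob_eq_0) auto
    then show ?thesis by simp
  next
    case False
    define c where "c = (exp 1 * B) powr p"
    have c: "0 < c" using False B by (simp add: c_def)
    have "prob {\<omega> \<in> space M. exp 1 * B < \<bar>X \<omega>\<bar>} \<le> prob {\<omega> \<in> space M. c \<le> ?Y \<omega>}"
      using X p B unfolding c_def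
      by (intro finite_measure_mono) (auto intro!: powr_mono2)
    also have "\<dots> \<le> m / c"
      unfolding m_def using int c by (intro integral_Markov_inequality_measure[where A = "{}"]) auto
    also have "\<dots> \<le> B powr p / c" using mB c by (intro divide_right_mono) auto
    also have "\<dots> = exp (- p)"
      using False B by (simp add: c_def powr_mult exp_powr_real exp_minus field_simps)
    finally show ?thesis .
  qed
qed

section \<open>Partition norms of tensors of a fixed format\<close>

definition block_vectors :: "(nat \<Rightarrow> nat) \<Rightarrow> nat set set \<Rightarrow> (nat set \<Rightarrow> (nat \<Rightarrow> nat) \<Rightarrow> real) set" where
  "block_vectors n P = {x. \<forall>I\<in>P. (\<Sum>j\<in>multi_idx n I. (x I j)\<^sup>2) \<le> 1}"

definition partition_form ::
  "nat \<Rightarrow> (nat \<Rightarrow> nat) \<Rightarrow> nat set set \<Rightarrow> ((nat \<Rightarrow> nat) \<Rightarrow> real) \<Rightarrow> (nat set \<Rightarrow> (nat \<Rightarrow> nat) \<Rightarrow> real) \<Rightarrow> real" where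
  "partition_form q n P a x = (\<Sum>i\<in>multi_idx n {1..q}. a i * (\<Prod>I\<in>P. x I (restrict i I)))"

lemma partition_norm_eq:
  "partition_norm q n P a = (SUP x\<in>block_vectors n P. ereal (partition_form q n P a x))"
  by (simp add: partition_norm_def block_vectors_def partition_form_def)

lemma finite_multi_idx: "finite I \<Longrightarrow> finite (multi_idx n I)"
  unfolding multi_idx_def by (intro finite_PiE) auto

lemma finite_partitions: "finite (partitions q)"
proof (rule finite_subset)
  show "partitions q \<subseteq> Pow (Pow {1..q})"
    by (auto simp: partitions_def partition_on_def)
qed auto

lemma partition_form_add:
  "partition_form q n P (\<lambda>i. a i + b i) x = partition_form q n P a x + partition_form q n P b x"
  by (simp add: partition_form_def distrib_right sum.distrib)

text \<open>\<open>real_of_ereal\<close> sends infinite values to 0, so this number becomes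
  meaningful through \<open>partition_norm_real\<close>, which rests on finiteness of the
  norm.\<close>

definition tensor_norm ::
  "nat \<Rightarrow> (nat \<Rightarrow> nat) \<Rightarrow> nat set set \<Rightarrow> ((nat \<Rightarrow> nat) \<Rightarrow> real) \<Rightarrow> real" where
  "tensor_norm q n P a = real_of_ereal (partition_norm q n P a)"

text \<open>Positivity of \<open>q\<close> provides a block. The empty partition of the empty set
  would give a form that ignores the vectors, and its supremum can be negative.\<close>

locale block_partition =
  fixes q :: nat and P :: "nat set set"
  assumes q_pos: "0 < q" and P: "P \<in> partitions q"
begin

lemma part: "partition_on {1..q} P"
  using P by (simp add: partitions_def)

lemma finite_P: "finite P"
  using part by (intro finite_elements[of "{1..q}"]) auto

lemma P_nonempty: "P \<noteq> {}"
  using part q_pos by (auto simp: partition_on_def)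

lemma card_P_pos: "0 < card P"
  using finite_P P_nonempty by (simp add: card_gt_0_iff)

lemma finite_block: "I \<in> P \<Longrightarrow> finite I"
  using part by (metis Sup_upper finite_atLeastAtMost finite_subset partition_on_def)

text \<open>Blocks are nonempty and their sizes add up to \<open>q\<close>. The bound later turns
  \<open>2 ^ card P\<close> into the uniform factor \<open>2 ^ q\<close> of
  \<open>chaos_const\<close>.\<close>

lemma card_P_le: "card P \<le> q"
proof -
  have "card P = (\<Sum>I\<in>P. 1)" by simp
  also have "\<dots> \<le> (\<Sum>I\<in>P. card I)"
    using part finite_block by (intro sum_mono) (force simp: partition_on_def Suc_le_eq card_gt_0_iff)
  also have "\<dots> = card {1..q}"
    using product_partition[OF part finite_block] by simp
  finally show ?thesis by simp
qed

lemma restrict_multi_idx: "I \<in> P \<Longrightarrow> i \<in> multi_idx n {1..q} \<Longrightarrow> restrict i I \<in> multi_idx n I"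
  using part by (fastforce simp: multi_idx_def partition_on_def PiE_iff)

lemma block_vectors_abs_le_1:
  assumes "x \<in> block_vectors n P" "I \<in> P" "j \<in> multi_idx n I"
  shows "\<bar>x I j\<bar> \<le> 1"
proof -
  have "(x I j)\<^sup>2 \<le> (\<Sum>j\<in>multi_idx n I. (x I j)\<^sup>2)"
    using assms(2,3) finite_multi_idx[OF finite_block] by (intro member_le_sum[of j]) auto
  also have "\<dots> \<le> 1" using assms(1,2) by (simp add: block_vectors_def)
  finally have "(x I j)\<^sup>2 \<le> 1" .
  then show ?thesis by (simp add: abs_square_le_1)
qed

text \<open>Entries of vectors in a Euclidean unit ball are at most 1 in absolute value, hence so
  are their products over the blocks.\<close>

lemma partition_form_le_l1:
  assumes "x \<in> block_vectors n P"
  shows "partition_form q n P a x \<le> (\<Sum>i\<in>multi_idx n {1..q}. \<bar>a i\<bar>)"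
  unfolding partition_form_def
proof (rule sum_mono)
  fix i assume i: "i \<in> multi_idx n {1..q}"
  have "\<bar>\<Prod>I\<in>P. x I (restrict i I)\<bar> \<le> 1"
    unfolding abs_prod
    using block_vectors_abs_le_1[OF assms _ restrict_multi_idx[OF _ i]]
    by (intro prod_le_1[of P "\<lambda>I. \<bar>x I (restrict i I)\<bar>"]) simp
  then have "\<bar>a i * (\<Prod>I\<in>P. x I (restrict i I))\<bar> \<le> \<bar>a i\<bar>"
    by (simp add: abs_mult mult_left_le)
  then show "a i * (\<Prod>I\<in>P. x I (restrict i I)) \<le> \<bar>a i\<bar>" by simp
qed

lemma partition_norm_nonneg: "0 \<le> partition_norm q n P a"
proof -
  \<comment> \<open>Zero vectors are admissible, and a product of zeros over the nonempty
    \<open>P\<close> is 0.\<close>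
  have "0 = partition_form q n P a (\<lambda>_ _. 0)"
    using card_P_pos by (simp add: partition_form_def zero_power)
  then show ?thesis
    unfolding partition_norm_eq
    by (intro SUP_upper2[of "\<lambda>_ _. 0"]) (auto simp: block_vectors_def)
qed

lemma partition_norm_le_l1: "partition_norm q n P a \<le> ereal (\<Sum>i\<in>multi_idx n {1..q}. \<bar>a i\<bar>)"
  unfolding partition_norm_eq by (intro SUP_least) (use partition_form_le_l1 in auto)

lemma partition_norm_real: "partition_norm q n P a = ereal (tensor_norm q n P a)"
  unfolding tensor_norm_def
  using partition_norm_nonneg[of n a] partition_norm_le_l1[of n a]
  by (cases "partition_norm q n P a") auto

lemma tensor_norm_nonneg: "0 \<le> tensor_norm q n P a"
  using partition_norm_nonneg[of n a] by (simp add: partition_norm_real)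

lemma tensor_norm_le_l1: "tensor_norm q n P a \<le> (\<Sum>i\<in>multi_idx n {1..q}. \<bar>a i\<bar>)"
  using partition_norm_le_l1[of n a] by (simp add: partition_norm_real)

lemma partition_form_le_tensor_norm:
  "x \<in> block_vectors n P \<Longrightarrow> partition_form q n P a x \<le> tensor_norm q n P a"
  \<comment> \<open>The inequality is lifted to \<open>ereal\<close>, where the norm is a
    supremum.\<close>
  unfolding ereal_less_eq(3)[symmetric] partition_norm_real[symmetric] partition_norm_eq
  by (rule SUP_upper)

lemma tensor_norm_least:
  assumes "\<And>x. x \<in> block_vectors n P \<Longrightarrow> partition_form q n P a x \<le> c"
  shows "tensor_norm q n P a \<le> c"
  unfolding ereal_less_eq(3)[symmetric] partition_norm_real[symmetric] partition_norm_eq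
  using assms by (intro SUP_least) auto

lemma tensor_norm_triangle:
  "tensor_norm q n P (\<lambda>i. a i + b i) \<le> tensor_norm q n P a + tensor_norm q n P b"
  by (intro tensor_norm_least)
    (auto simp: partition_form_add intro: add_mono partition_form_le_tensor_norm)

text \<open>Flipping the sign of one block vector flips the sign of the form.\<close>

lemma tensor_norm_uminus_le: "tensor_norm q n P (\<lambda>i. - a i) \<le> tensor_norm q n P a"
proof (rule tensor_norm_least)
  fix x assume x: "x \<in> block_vectors n P"
  obtain B where B: "B \<in> P" using P_nonempty by auto
  define y where "y = x(B := \<lambda>j. - x B j)"
  have y: "y \<in> block_vectors n P" using x by (auto simp: block_vectors_def y_def)
  have "(\<Prod>I\<in>P. y I (restrict i I)) = - (\<Prod>I\<in>P. x I (restrict i I))" for i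
  proof -
    have "(\<Prod>I\<in>P - {B}. y I (restrict i I)) = (\<Prod>I\<in>P - {B}. x I (restrict i I))"
      by (intro prod.cong) (auto simp: y_def)
    moreover have "y B (restrict i B) = - x B (restrict i B)" by (simp add: y_def)
    ultimately show ?thesis
      using prod.remove[OF finite_P B, of "\<lambda>I. y I (restrict i I)"]
        prod.remove[OF finite_P B, of "\<lambda>I. x I (restrict i I)"] by (metis mult_minus_left)
  qed
  then have "partition_form q n P (\<lambda>i. - a i) x = partition_form q n P a y"
    by (simp add: partition_form_def)
  then show "partition_form q n P (\<lambda>i. - a i) x \<le> tensor_norm q n P a"
    using partition_form_le_tensor_norm[OF y] by simp
qed

lemma tensor_norm_uminus: "tensor_norm q n P (\<lambda>i. - a i) = tensor_norm q n P a"
  using tensor_norm_uminus_le[of n a] tensor_norm_uminus_le[of n "\<lambda>i. - a i"] by simp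

lemma tensor_norm_commute: "tensor_norm q n P (\<lambda>i. a i - b i) = tensor_norm q n P (\<lambda>i. b i - a i)"
  using tensor_norm_uminus[of n "\<lambda>i. a i - b i"] by simp

text \<open>The test vectors are, on each block, the indicator of the sub-index of \<open>k\<close>.
  As the blocks cover \<open>{1..q}\<close>, their product is the indicator of \<open>k\<close>, so
  the form evaluates the entry at \<open>k\<close>; using both \<open>a\<close> and
  \<open>- a\<close> gives the absolute value.\<close>

lemma coord_le_tensor_norm:
  assumes k: "k \<in> multi_idx n {1..q}"
  shows "\<bar>a k\<bar> \<le> tensor_norm q n P a"
proof -
  define x :: "nat set \<Rightarrow> (nat \<Rightarrow> nat) \<Rightarrow> real" where
    "x I j = (if j = restrict k I then 1 else 0)" for I j
  have x: "x \<in> block_vectors n P"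
  proof -
    have "(\<Sum>j\<in>multi_idx n I. (x I j)\<^sup>2) \<le> 1" if "I \<in> P" for I
    proof -
      have "(\<Sum>j\<in>multi_idx n I. (x I j)\<^sup>2) = (\<Sum>j\<in>multi_idx n I. if j = restrict k I then 1 else 0)"
        by (intro sum.cong) (auto simp: x_def)
      also have "\<dots> \<le> 1"
        using finite_multi_idx[OF finite_block[OF that]] by (simp add: sum.delta)
      finally show ?thesis .
    qed
    then show ?thesis by (simp add: block_vectors_def)
  qed
  have prod: "(\<Prod>I\<in>P. x I (restrict i I)) = (if i = k then 1 else 0)"
    if i: "i \<in> multi_idx n {1..q}" for i
  proof (cases "i = k")
    case False
    \<comment> \<open>Multi-indices are extensional on \<open>{1..q}\<close>, so distinct ones
      differ at some \<open>r\<close> there, and the block containing \<open>r\<close> contributes a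
      factor 0.\<close>
    then obtain r where r: "r \<in> {1..q}" "i r \<noteq> k r"
      using i k PiE_ext unfolding multi_idx_def by metis
    then obtain I where I: "I \<in> P" "r \<in> I"
      using partition_onD1[OF part] by blast
    then have "restrict i I \<noteq> restrict k I" using r(2) by (metis restrict_apply')
    then show ?thesis
      using False I finite_P by (auto simp: x_def intro!: bexI[of _ I])
  qed (simp add: x_def)
  have form: "partition_form q n P b x = b k" for b
  proof -
    have "partition_form q n P b x = (\<Sum>i\<in>multi_idx n {1..q}. if i = k then b i else 0)"
      unfolding partition_form_def by (intro sum.cong) (auto simp: prod)
    then show ?thesis using k by (simp add: finite_multi_idx)
  qed
  have "a k \<le> tensor_norm q n P a" "- a k \<le> tensor_norm q n P (\<lambda>i. - a i)"
    using partition_form_le_tensor_norm[OF x, of a]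
      partition_form_le_tensor_norm[OF x, of "\<lambda>i. - a i"] by (simp_all add: form)
  then show ?thesis by (simp add: tensor_norm_uminus abs_le_iff)
qed

end

section \<open>Gaussian chaos: the moment inequality and the tail bound\<close>

lemma prob_space_std_normal: "prob_space (density lborel (\<lambda>x. ennreal (std_normal_density x)))"
  by (rule prob_space_normal_density) simp

lemma prob_space_std_gauss: "prob_space (std_gauss m)"
  unfolding std_gauss_def by (intro prob_space_PiM prob_space_std_normal)

text \<open>Tensor and vectors may both depend on \<open>z\<close>, so one statement serves the
  canonical space, a fixed tensor on \<open>M\<close>, and the process on the product space.\<close>

lemma measurable_chaos_form:
  assumes a: "\<And>i. i \<in> multi_idx n {1..q} \<Longrightarrow> (\<lambda>z. a z i) \<in> borel_measurable N"
    and x: "\<And>r. r \<in> {1..q} \<Longrightarrow> (\<lambda>z. x z r) \<in> measurable N (PiM {1..n r} (\<lambda>_. borel))"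
  shows "(\<lambda>z. chaos_form q n (a z) (x z)) \<in> borel_measurable N"
proof -
  have "(\<lambda>z. x z r (i r)) \<in> borel_measurable N" if "i \<in> multi_idx n {1..q}" "r \<in> {1..q}" for i r
    using that by (intro measurable_compose[OF x measurable_component_singleton])
      (auto simp: multi_idx_def PiE_iff)
  then show ?thesis
    unfolding chaos_form_def
    by (intro borel_measurable_sum borel_measurable_times borel_measurable_prod a)
qed

text \<open>Joint laws live on extensional functions, so the family \<open>g\<close> is restricted
  to \<open>{1..q}\<close> before its law is taken.\<close>

lemma chaos_form_restrict: "chaos_form q n a (restrict x {1..q}) = chaos_form q n a x"
  by (simp add: chaos_form_def)

lemma chaos_form_diff:
  "chaos_form q n (\<lambda>i. a i - b i) x = chaos_form q n a x - chaos_form q n b x"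
  by (simp add: chaos_form_def left_diff_distrib sum_subtractf)

lemma abs_chaos_form_le:
  assumes "\<And>i. i \<in> multi_idx n {1..q} \<Longrightarrow> \<bar>a i\<bar> \<le> c"
  shows "\<bar>chaos_form q n a x\<bar> \<le> c * (\<Sum>i\<in>multi_idx n {1..q}. \<bar>\<Prod>r\<in>{1..q}. x r (i r)\<bar>)"
  unfolding chaos_form_def sum_distrib_left
  by (rule order_trans[OF sum_abs]) (auto simp: abs_mult intro!: sum_mono mult_right_mono assms)

lemma Lp_norm_distr:
  assumes "f \<in> measurable M N" "X \<in> borel_measurable N"
  shows "Lp_norm (distr M N f) p X = Lp_norm M p (\<lambda>\<omega>. X (f \<omega>))"
  using assms by (simp add: Lp_norm_def integrable_distr_eq integral_distr)

text \<open>A nonpositive constant would force the product of \<open>q\<close> independent standard normal variables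
  to vanish almost surely.\<close>

lemma latala_constant_pos:
  assumes q: "0 < q" and lat: "latala_constant q L"
  shows "0 < L"
proof (rule ccontr)
  assume "\<not> 0 < L"
  then have L: "L \<le> 0" by simp
  \<comment> \<open>The smallest format has a single multi-index; with entry 1 the chaos is just the
    product of \<open>q\<close> variables.\<close>
  define n :: "nat \<Rightarrow> nat" where "n = (\<lambda>_. 1)"
  define a :: "(nat \<Rightarrow> nat) \<Rightarrow> real" where "a = (\<lambda>_. 1)"
  define N where "N = PiM {1..q} (\<lambda>r. std_gauss (n r))"
  interpret N: prob_space N
    unfolding N_def by (intro prob_space_PiM prob_space_std_gauss)
  have "multi_idx n {1..q} = {\<lambda>r\<in>{1..q}. 1}"
    using PiE_singleton[of "\<lambda>r\<in>{1..q}. 1::nat" "{1..q}"]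
    unfolding multi_idx_def n_def by (auto cong: PiE_cong)
  then have form: "chaos_form q n a x = (\<Prod>r\<in>{1..q}. x r 1)" for x
    by (simp add: chaos_form_def a_def)
  have "AE x in N. x r 1 \<noteq> 0" if r: "r \<in> {1..q}" for r
  proof -
    have "AE y in density lborel (\<lambda>x. ennreal (std_normal_density x)). y \<noteq> 0"
      by (subst AE_density) (auto intro: AE_mp[OF AE_lborel_singleton])
    then have "AE y in std_gauss (n r). y 1 \<noteq> 0"
      unfolding std_gauss_def by (intro AE_PiM_component prob_space_std_normal) (auto simp: n_def)
    then show ?thesis
      unfolding N_def using r by (intro AE_PiM_component prob_space_std_gauss)
  qed
  then have "AE x in N. \<forall>r\<in>{1..q}. x r 1 \<noteq> 0"
    by (intro AE_finite_allI) auto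
  then have nz: "AE x in N. chaos_form q n a x \<noteq> 0"
    by eventually_elim (auto simp: form)
  \<comment> \<open>A nonnegative sum times \<open>L \<le> 0\<close> will force the second moment to
    vanish.\<close>
  have "0 \<le> (\<Sum>P\<in>partitions q. ereal (2 powr (real (card P) / 2)) * partition_norm q n P a)"
    by (intro sum_nonneg ereal_0_le_mult block_partition.partition_norm_nonneg)
      (auto simp: block_partition_def q)
  then have "ereal L * (\<Sum>P\<in>partitions q. ereal (2 powr (real (card P) / 2)) * partition_norm q n P a) \<le> 0"
    using L by (simp add: ereal_mult_le_0_iff)
  then have le: "Lp_norm N 2 (chaos_form q n a) \<le> 0"
    using lat[unfolded latala_constant_def, rule_format, of n 2 a] unfolding N_def
    by (auto simp: n_def intro: order_trans)
  have int: "integrable N (\<lambda>x. \<bar>chaos_form q n a x\<bar> powr 2)"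
    using le by (auto simp: Lp_norm_def split: if_splits)
  have "(\<integral>x. \<bar>chaos_form q n a x\<bar> powr 2 \<partial>N) = 0"
    using le int by (simp add: Lp_norm_def split: if_splits)
  then have "AE x in N. \<bar>chaos_form q n a x\<bar> powr 2 = 0"
    using integral_nonneg_eq_0_iff_AE[OF int] by simp
  with nz have "AE x in N. False" by eventually_elim simp
  then show False by simp
qed

text \<open>Moments depend only on the joint law. Independence makes it the product of the marginal
  laws, so the inequality transfers from the canonical space to \<open>M\<close>.\<close>

lemma (in prob_space) latala_chaos_form:
  assumes q: "0 < q" and n: "\<forall>r\<in>{1..q}. 0 < n r" and p: "2 \<le> p"
    and indep: "indep_vars (\<lambda>r. PiM {1..n r} (\<lambda>_. borel)) g {1..q}"
    and law: "\<forall>r\<in>{1..q}. distr M (PiM {1..n r} (\<lambda>_. borel)) (g r) = std_gauss (n r)"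
    and lat: "latala_constant q L"
  shows "Lp_norm M p (\<lambda>\<omega>. chaos_form q n a (\<lambda>r. g r \<omega>)) \<le>
    ereal (L * (\<Sum>P\<in>partitions q. p powr (real (card P) / 2) * tensor_norm q n P a))"
proof -
  define N where "N = PiM {1..q} (\<lambda>r. PiM {1..n r} (\<lambda>_. borel :: real measure))"
  define f where "f \<omega> = (\<lambda>r\<in>{1..q}. g r \<omega>)" for \<omega>
  have g: "g r \<in> measurable M (PiM {1..n r} (\<lambda>_. borel))" if "r \<in> {1..q}" for r
    using indep that by (auto simp: indep_vars_def)
  have f: "f \<in> measurable M N"
    unfolding f_def N_def using g by (intro measurable_restrict) auto
  have X: "chaos_form q n a \<in> borel_measurable N"
    unfolding N_def by (intro measurable_chaos_form measurable_component_singleton) auto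
  have "distr M N f = PiM {1..q} (\<lambda>r. distr M (PiM {1..n r} (\<lambda>_. borel)) (g r))"
    unfolding N_def f_def using indep q g
    by (subst indep_vars_iff_distr_eq_PiM'[symmetric]) auto
  also have "\<dots> = PiM {1..q} (\<lambda>r. std_gauss (n r))"
    using law by (intro PiM_cong) auto
  finally have "Lp_norm (PiM {1..q} (\<lambda>r. std_gauss (n r))) p (chaos_form q n a)
      = Lp_norm M p (\<lambda>\<omega>. chaos_form q n a (f \<omega>))"
    using Lp_norm_distr[OF f X, of p] by simp
  also have "(\<lambda>\<omega>. chaos_form q n a (f \<omega>)) = (\<lambda>\<omega>. chaos_form q n a (\<lambda>r. g r \<omega>))"
    unfolding f_def chaos_form_restrict ..
  finally have "Lp_norm M p (\<lambda>\<omega>. chaos_form q n a (\<lambda>r. g r \<omega>)) \<le>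
      ereal L * (\<Sum>P\<in>partitions q. ereal (p powr (real (card P) / 2)) * partition_norm q n P a)"
    using lat[unfolded latala_constant_def, rule_format, of n p a] n p by simp
  also have "\<dots> = ereal (L * (\<Sum>P\<in>partitions q. p powr (real (card P) / 2) * tensor_norm q n P a))"
    by (simp add: block_partition.partition_norm_real block_partition_def q cong: sum.cong)
  finally show ?thesis .
qed

text \<open>For \<open>u \<le> 1/2\<close> the bound exceeds 1. Otherwise apply the moment inequality with
  \<open>p = max 2 u \<le> 4 u\<close>: the factor \<open>4 ^ (|P| / 2) \<le> 2 ^ q\<close> is absorbed into the constant.\<close>

lemma (in prob_space) chaos_form_tail:
  assumes q: "0 < q" and n: "\<forall>r\<in>{1..q}. 0 < n r" and u: "0 \<le> u"
    and indep: "indep_vars (\<lambda>r. PiM {1..n r} (\<lambda>_. borel)) g {1..q}"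
    and law: "\<forall>r\<in>{1..q}. distr M (PiM {1..n r} (\<lambda>_. borel)) (g r) = std_gauss (n r)"
    and lat: "latala_constant q L"
  shows "prob {\<omega> \<in> space M.
      (\<Sum>P\<in>partitions q. u powr (real (card P) / 2) * (chaos_const q L * tensor_norm q n P a))
        < \<bar>chaos_form q n a (\<lambda>r. g r \<omega>)\<bar>} \<le> 2 * exp (- u)" (is "prob ?E \<le> _")
proof (cases "u \<le> 1 / 2")
  case True
  \<comment> \<open>Squaring avoids logarithms: \<open>exp 1 \<le> 3 < 4\<close> yields
    \<open>exp u \<le> 2\<close>.\<close>
  have "exp u * exp u \<le> exp (1::real)"
    using True by (simp flip: exp_add)
  also have "\<dots> \<le> 2 * 2" using exp_le by simp
  finally have "exp u \<le> 2"
    using mult_strict_mono[of 2 "exp u" 2 "exp u"] by force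
  then have "1 \<le> 2 * exp (- u)" by (simp add: exp_minus field_simps)
  then show ?thesis using prob_le_1[of ?E] by linarith
next
  case False
  define p where "p = max 2 u"
  \<comment> \<open>\<open>u > 1 / 2\<close> gives \<open>p \<le> 4 * u\<close> when
    \<open>p = 2\<close>.\<close>
  have p: "2 \<le> p" "u \<le> p" "p \<le> 4 * u" using False by (auto simp: p_def)
  have L: "0 < L" by (rule latala_constant_pos[OF q lat])
  have tn: "0 \<le> tensor_norm q n P a" if "P \<in> partitions q" for P
    using that q by (intro block_partition.tensor_norm_nonneg) (simp add: block_partition_def)
  define B where "B = L * (\<Sum>P\<in>partitions q. p powr (real (card P) / 2) * tensor_norm q n P a)"
  have B: "0 \<le> B" unfolding B_def using L tn by (intro mult_nonneg_nonneg sum_nonneg) auto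
  let ?X = "\<lambda>\<omega>. chaos_form q n a (\<lambda>r. g r \<omega>)"
  have X: "?X \<in> borel_measurable M"
    using indep by (intro measurable_chaos_form) (auto simp: indep_vars_def)
  have pow: "p powr (real (card P) / 2) \<le> 2 ^ q * u powr (real (card P) / 2)"
    if P: "P \<in> partitions q" for P
  proof -
    have "p powr (real (card P) / 2) \<le> (4 * u) powr (real (card P) / 2)"
      using p by (intro powr_mono2) auto
    also have "\<dots> = 4 powr (real (card P) / 2) * u powr (real (card P) / 2)"
      using u by (simp add: powr_mult)
    also have "4 powr (real (card P) / 2) = (2 powr 2) powr (real (card P) / 2)"
      by simp
    also have "\<dots> = 2 ^ card P" unfolding powr_powr by (simp add: powr_realpow)
    also have "2 ^ card P * u powr (real (card P) / 2) \<le> 2 ^ q * u powr (real (card P) / 2)"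
      using block_partition.card_P_le[of q P] P q
      by (intro mult_right_mono power_increasing) (auto simp: block_partition_def)
    finally show ?thesis .
  qed
  \<comment> \<open>The factors \<open>exp 1\<close> from Markov's inequality and
    \<open>2 ^ q\<close> from \<open>pow\<close> are those in \<open>chaos_const\<close>. The mixed
    threshold is thus at least \<open>exp 1 * B\<close>, and exceeding it is the smaller
    event.\<close>
  have "exp 1 * B = (\<Sum>P\<in>partitions q.
      p powr (real (card P) / 2) * (exp 1 * L * tensor_norm q n P a))"
    by (simp add: B_def sum_distrib_left mult_ac)
  also have "\<dots> \<le> (\<Sum>P\<in>partitions q.
      (2 ^ q * u powr (real (card P) / 2)) * (exp 1 * L * tensor_norm q n P a))"
    using L tn pow by (intro sum_mono mult_right_mono) auto
  also have "\<dots> = (\<Sum>P\<in>partitions q.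
      u powr (real (card P) / 2) * (chaos_const q L * tensor_norm q n P a))"
    by (simp add: chaos_const_def mult_ac)
  finally have "?E \<subseteq> {\<omega> \<in> space M. exp 1 * B < \<bar>?X \<omega>\<bar>}" by auto
  then have "prob ?E \<le> prob {\<omega> \<in> space M. exp 1 * B < \<bar>?X \<omega>\<bar>}"
    using X by (intro finite_measure_mono) auto
  also have "\<dots> \<le> exp (- p)"
    using X p B latala_chaos_form[OF q n p(1) indep law lat, of a] unfolding B_def
    by (intro prob_gt_Lp_norm) auto
  also have "\<dots> \<le> 2 * exp (- u)"
    using p(2) by (smt (verit) exp_le_cancel_iff exp_gt_zero)
  finally show ?thesis .
qed

section \<open>The pseudo-metrics and the sample paths\<close>

lemma block_partitionI: "0 < q \<Longrightarrow> P \<in> partitions q \<Longrightarrow> block_partition q P"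
  by (simp add: block_partition_def)

text \<open>Write \<open>a = b + (a - b)\<close>. This supplies the hypothesis \<open>lip\<close> of
  \<open>borel_measurable_l1_lipschitz\<close>.\<close>

lemma (in block_partition) tensor_norm_lipschitz:
  "tensor_norm q n P a \<le> tensor_norm q n P b + l1_dist (multi_idx n {1..q}) a b"
  using tensor_norm_triangle[of n b "\<lambda>i. a i - b i"] tensor_norm_le_l1[of n "\<lambda>i. a i - b i"]
  by (simp add: l1_dist_def)

text \<open>The part of the setting without probability. \<open>0 < L\<close> gives
  \<open>0 < K\<close>, hence nonnegative distances and control of increments by \<rho>.\<close>

locale chaos_metric =
  fixes q :: nat and n :: "nat \<Rightarrow> nat" and L :: real
    and T :: "'t measure" and A :: "'t \<Rightarrow> (nat \<Rightarrow> nat) \<Rightarrow> real"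
  assumes q: "0 < q" and L: "0 < L"
    and A: "A \<in> measurable T (PiM (multi_idx n {1..q}) (\<lambda>_. borel))"
begin

abbreviation "K \<equiv> chaos_const q L"
abbreviation "tdist P s t \<equiv> tensor_norm q n P (\<lambda>i. A s i - A t i)"

lemma K_pos: "0 < K"
  using L by (simp add: chaos_const_def)

lemma chaos_dist_real: "P \<in> partitions q \<Longrightarrow> chaos_dist q n L A P s t = ereal (K * tdist P s t)"
  using q by (simp add: chaos_dist_def block_partition.partition_norm_real block_partitionI)

lemma chaos_rho_real: "chaos_rho q n L A s t = ereal (\<Sum>P\<in>partitions q. K * tdist P s t)"
  by (simp add: chaos_rho_def chaos_dist_real cong: sum.cong)

lemma finite_valued_chaos_dist: "P \<in> partitions q \<Longrightarrow> finite_valued_on S (chaos_dist q n L A P)"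
  by (simp add: finite_valued_on_def chaos_dist_real)

lemma pseudo_metric_chaos_dist:
  assumes P: "P \<in> partitions q"
  shows "pseudo_metric_on S (chaos_dist q n L A P)"
proof -
  interpret block_partition q P using q P by (rule block_partitionI)
  have "tensor_norm q n P (\<lambda>i. 0) = 0"
    using tensor_norm_nonneg[of n "\<lambda>i. 0"] tensor_norm_le_l1[of n "\<lambda>i. 0"] by simp
  moreover have "K * tdist P r t \<le> K * tdist P r s + K * tdist P s t" for r s t
    using tensor_norm_triangle[of n "\<lambda>i. A r i - A s i" "\<lambda>i. A s i - A t i"] K_pos
    by (simp flip: distrib_left)
  ultimately show ?thesis
    using K_pos tensor_norm_commute tensor_norm_nonneg
    by (auto simp: pseudo_metric_on_def chaos_dist_real[OF P])
qed

lemma coord_measurable: "i \<in> multi_idx n {1..q} \<Longrightarrow> (\<lambda>t. A t i) \<in> borel_measurable T"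
  using measurable_compose[OF A measurable_component_singleton] .

text \<open>The supremum runs over an uncountable set, so measurability is obtained from Lipschitz
  dependence on the finitely many coordinates of \<open>A\<^sub>s - A\<^sub>t\<close>, each
  measurable on the product.\<close>

lemma measurable_chaos_dist:
  assumes P: "P \<in> partitions q"
  shows "jointly_measurable_dist T (chaos_dist q n L A P)"
proof -
  interpret block_partition q P using q P by (rule block_partitionI)
  have "(\<lambda>z. ereal (tensor_norm q n P (\<lambda>i. A (fst z) i - A (snd z) i))) \<in> borel_measurable (T \<Otimes>\<^sub>M T)"
  proof (rule borel_measurable_l1_lipschitz[where J = "multi_idx n {1..q}"
        and F = "\<lambda>z i. A (fst z) i - A (snd z) i"])
    fix i assume "i \<in> multi_idx n {1..q}"
    note [measurable] = coord_measurable[OF this]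
    show "(\<lambda>z. A (fst z) i - A (snd z) i) \<in> borel_measurable (T \<Otimes>\<^sub>M T)" by measurable
  qed (simp_all only: finite_multi_idx finite_atLeastAtMost tensor_norm_lipschitz)
  then have "(\<lambda>z. ereal K * ereal (tensor_norm q n P (\<lambda>i. A (fst z) i - A (snd z) i)))
      \<in> borel_measurable (T \<Otimes>\<^sub>M T)"
    by (intro borel_measurable_ereal_times borel_measurable_const)
  then show ?thesis
    by (simp add: jointly_measurable_dist_def chaos_dist_real[OF P] case_prod_beta)
qed

text \<open>Up to the factor \<open>C\<close>, \<rho> is dominated by the l1 distance of the
  tensors, so a set dense for the latter is dense for the former.\<close>

lemma separable_chaos_rho: "separable_wrt S (chaos_rho q n L A)"
proof -
  let ?J = "multi_idx n {1..q}"
  define C where "C = real (card (partitions q)) * K"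
  have C: "0 \<le> C" using K_pos by (simp add: C_def)
  obtain D where D: "countable D" "D \<subseteq> S"
      "\<And>t e. t \<in> S \<Longrightarrow> 0 < e \<Longrightarrow> \<exists>s\<in>D. l1_dist ?J (A t) (A s) < e"
    using l1_dist_separable[of ?J S A] finite_multi_idx by blast
  have bound: "(\<Sum>P\<in>partitions q. K * tdist P t s) \<le> C * l1_dist ?J (A t) (A s)" for t s
  proof -
    have "K * tdist P t s \<le> K * l1_dist ?J (A t) (A s)" if "P \<in> partitions q" for P
      using block_partition.tensor_norm_le_l1[OF block_partitionI[OF q that]] K_pos
      by (simp add: l1_dist_def)
    then have "(\<Sum>P\<in>partitions q. K * tdist P t s)
        \<le> (\<Sum>P\<in>partitions q. K * l1_dist ?J (A t) (A s))"
      by (rule sum_mono)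
    then show ?thesis by (simp add: C_def mult_ac)
  qed
  have "\<exists>s\<in>D. chaos_rho q n L A t s < ereal e" if t: "t \<in> S" and e: "0 < e" for t e
  proof -
    obtain s where s: "s \<in> D" "l1_dist ?J (A t) (A s) < e / (C + 1)"
      using D(3)[OF t, of "e / (C + 1)"] e C by auto
    have "C * l1_dist ?J (A t) (A s) \<le> (C + 1) * l1_dist ?J (A t) (A s)"
      using l1_dist_nonneg[of ?J "A t" "A s"] by (intro mult_right_mono) auto
    also have "\<dots> < e" using s(2) C by (simp add: field_simps)
    finally show ?thesis
      using s(1) bound[of t s] by (intro bexI[of _ s]) (auto simp: chaos_rho_real)
  qed
  then show ?thesis
    using D(1,2) unfolding separable_wrt_def by blast
qed

text \<open>Every partition norm dominates the maximum of the absolute values of the entries, so every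
  sample path, not just almost every one, is Lipschitz.\<close>

lemma continuous_chaos_process:
  "continuous_wrt S (chaos_rho q n L A) (\<lambda>t. chaos_process q n A g t \<omega>)"
proof -
  \<comment> \<open>For fixed \<omega>, \<open>W / K\<close> will be a Lipschitz constant of the
    path.\<close>
  define W where "W = (\<Sum>i\<in>multi_idx n {1..q}. \<bar>\<Prod>r\<in>{1..q}. g r \<omega> (i r)\<bar>)"
  have W: "0 \<le> W" by (simp add: W_def sum_nonneg)
  \<comment> \<open>The one-block partition gives a single summand of \<rho> that already controls
    every entry of the increment.\<close>
  have Q: "{{1..q}} \<in> partitions q"
    using q by (simp add: partitions_def partition_on_space)
  have lip: "\<bar>chaos_process q n A g s \<omega> - chaos_process q n A g t \<omega>\<bar> * K
      \<le> (\<Sum>P\<in>partitions q. K * tdist P t s) * W" for s t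
  proof -
    have nonneg: "0 \<le> K * tdist P t s" if "P \<in> partitions q" for P
      using block_partition.tensor_norm_nonneg[OF block_partitionI[OF q that]] K_pos by simp
    have "\<bar>chaos_process q n A g t \<omega> - chaos_process q n A g s \<omega>\<bar> \<le> tdist {{1..q}} t s * W"
      unfolding chaos_process_def chaos_form_diff[symmetric] W_def
      by (intro abs_chaos_form_le block_partition.coord_le_tensor_norm block_partitionI q Q)
    then have "\<bar>chaos_process q n A g s \<omega> - chaos_process q n A g t \<omega>\<bar> * K
        \<le> (K * tdist {{1..q}} t s) * W"
      using K_pos by (simp add: abs_minus_commute mult_ac)
    also have "\<dots> \<le> (\<Sum>P\<in>partitions q. K * tdist P t s) * W"
      using W Q finite_partitions nonneg
      by (intro mult_right_mono member_le_sum[of "{{1..q}}"]) auto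
    finally show ?thesis .
  qed
  show ?thesis
    unfolding continuous_wrt_def
  proof (intro ballI allI impI)
    fix t e assume e: "(0::real) < e"
    show "\<exists>\<delta>>0. \<forall>s\<in>S. chaos_rho q n L A t s < ereal \<delta> \<longrightarrow>
        dist (chaos_process q n A g s \<omega>) (chaos_process q n A g t \<omega>) < e"
    \<comment> \<open>The radius is chosen so that its product with \<open>W\<close> stays below
      \<open>e * K\<close>; \<open>W + 1\<close> covers \<open>W = 0\<close>.\<close>
    proof (intro exI[of _ "e * K / (W + 1)"] conjI ballI impI)
      show "0 < e * K / (W + 1)" using e K_pos W by simp
      fix s assume "chaos_rho q n L A t s < ereal (e * K / (W + 1))"
      then have rho: "(\<Sum>P\<in>partitions q. K * tdist P t s) < e * K / (W + 1)"
        by (simp add: chaos_rho_real)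
      have "\<bar>chaos_process q n A g s \<omega> - chaos_process q n A g t \<omega>\<bar> * K \<le> e * K / (W + 1) * W"
        using lip[of s t] mult_right_mono[OF less_imp_le[OF rho] W] by linarith
      also have "\<dots> < e * K" using e K_pos W by (simp add: field_simps)
      finally show "dist (chaos_process q n A g s \<omega>) (chaos_process q n A g t \<omega>) < e"
        using K_pos by (simp add: dist_real_def)
    qed
  qed
qed

lemma measurable_chaos_process:
  assumes "\<And>r. r \<in> {1..q} \<Longrightarrow> g r \<in> measurable M (PiM {1..n r} (\<lambda>_. borel))"
  shows "jointly_measurable_process M T (chaos_process q n A g)"
proof -
  have "(\<lambda>z. chaos_form q n (A (fst z)) (\<lambda>r. g r (snd z))) \<in> borel_measurable (T \<Otimes>\<^sub>M M)"
    by (intro measurable_chaos_form measurable_compose[OF measurable_fst coord_measurable]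
      measurable_compose[OF measurable_snd assms])
  then show ?thesis
    by (simp add: jointly_measurable_process_def chaos_process_def case_prod_beta)
qed

end

section \<open>The chaos process as a mixed-tail process\<close>

theorem proposition5p2:
  fixes q :: nat and n :: "nat \<Rightarrow> nat" and L :: real
    and M :: "'w measure" and g :: "nat \<Rightarrow> 'w \<Rightarrow> nat \<Rightarrow> real"
    and T :: "'t measure" and A :: "'t \<Rightarrow> (nat \<Rightarrow> nat) \<Rightarrow> real" and t0 :: 't
  assumes "2 \<le> q" and "\<forall>r\<in>{1..q}. 0 < n r"
    and "prob_space M"
    and "prob_space.indep_vars M (\<lambda>r. PiM {1..n r} (\<lambda>_. borel)) g {1..q}"
    and "\<forall>r\<in>{1..q}. distr M (PiM {1..n r} (\<lambda>_. borel)) (g r) = std_gauss (n r)"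
    and "standard_borel_space T"
    and "A \<in> measurable T (PiM (multi_idx n {1..q}) (\<lambda>_. borel))"
    and "t0 \<in> space T" and "\<forall>i\<in>multi_idx n {1..q}. A t0 i = 0"
    and "latala_constant q L"
  shows "(\<forall>P\<in>partitions q.
            finite_valued_on (space T) (chaos_dist q n L A P) \<and>
            pseudo_metric_on (space T) (chaos_dist q n L A P) \<and>
            jointly_measurable_dist T (chaos_dist q n L A P)) \<and>
         separable_wrt (space T) (chaos_rho q n L A) \<and>
         (\<forall>s\<in>space T. \<forall>t\<in>space T. \<forall>u\<ge>0.
            measure M {\<omega> \<in> space M.
                ereal \<bar>chaos_process q n A g s \<omega> - chaos_process q n A g t \<omega>\<bar> >
                (\<Sum>P\<in>partitions q. ereal (u powr (real (card P) / 2)) * chaos_dist q n L A P s t)}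
              \<le> 2 * exp (- u)) \<and>
         jointly_measurable_process M T (chaos_process q n A g) \<and>
         (AE \<omega> in M. continuous_wrt (space T) (chaos_rho q n L A) (\<lambda>t. chaos_process q n A g t \<omega>)) \<and>
         anchored_mixed_tail_process (bell q) M T (partitions q) (\<lambda>P. 2 / real (card P))
           (chaos_dist q n L A) (chaos_process q n A g)"
proof -
  interpret prob_space M by fact
  have q: "0 < q" using assms(1) by simp
  interpret chaos_metric q n L T A
    using q assms(7) latala_constant_pos[OF q assms(10)] by unfold_locales
  \<comment> \<open>The form is linear in the tensor, so the increment is the chaos of
    \<open>A\<^sub>s - A\<^sub>t\<close>.\<close>
  have tail: "prob {\<omega> \<in> space M.
      ereal \<bar>chaos_process q n A g s \<omega> - chaos_process q n A g t \<omega>\<bar> >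
      (\<Sum>P\<in>partitions q. ereal (u powr (real (card P) / 2)) * chaos_dist q n L A P s t)}
      \<le> 2 * exp (- u)" if "0 \<le> u" for s t u
    using chaos_form_tail[OF q assms(2) that assms(4,5,10), of "\<lambda>i. A s i - A t i"]
    by (simp add: chaos_process_def chaos_dist_real chaos_form_diff cong: sum.cong)
  have meas: "jointly_measurable_process M T (chaos_process q n A g)"
    using assms(4) by (intro measurable_chaos_process) (auto simp: indep_vars_def)
  have rho: "(\<lambda>s t. \<Sum>P\<in>partitions q. chaos_dist q n L A P s t) = chaos_rho q n L A"
    by (simp add: chaos_rho_def fun_eq_iff)
  have cont: "AE \<omega> in M. continuous_wrt (space T) (chaos_rho q n L A) (\<lambda>t. chaos_process q n A g t \<omega>)"
    by (simp add: continuous_chaos_process)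
  have "chaos_process q n A g t0 \<omega> = 0" for \<omega>
    using assms(9) by (simp add: chaos_process_def chaos_form_def)
  \<comment> \<open>The tail bound in the shape of the definition: exponents as reciprocals of the
    orders, and \<open>s\<close> and \<open>t\<close> exchanged.\<close>
  moreover have "prob {\<omega> \<in> space M.
      ereal (norm (chaos_process q n A g t \<omega> - chaos_process q n A g s \<omega>)) >
      (\<Sum>P\<in>partitions q. ereal (u powr (1 / (2 / real (card P)))) * chaos_dist q n L A P t s)}
      \<le> 2 * exp (- u)" if "0 \<le> u" for s t u
    using tail[OF that, of t s] by simp
  ultimately have "anchored_mixed_tail_process (bell q) M T (partitions q) (\<lambda>P. 2 / real (card P))
      (chaos_dist q n L A) (chaos_process q n A g)"
    unfolding anchored_mixed_tail_process_def rho
    using assms(8) meas cont separable_chaos_rho finite_partitions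
      finite_valued_chaos_dist pseudo_metric_chaos_dist measurable_chaos_dist
      block_partition.card_P_pos[OF block_partitionI[OF q]]
    \<comment> \<open>Deleting these simp rules keeps exponents and norm in the form of the fact
      just proved.\<close>
    by (auto simp: bell_def simp del: divide_divide_eq_right real_norm_def intro!: bexI[of _ t0])
  then show ?thesis
    using tail meas cont separable_chaos_rho
      finite_valued_chaos_dist pseudo_metric_chaos_dist measurable_chaos_dist by simp
qed

end
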